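(* Let $k\ge 4$ be even and let $G$ be a simple graph, possibly with loops. Let $\lambda$ be an $H$-eigenvalue of $\mathcal{A}(G^{k,k/2})$ (respectively, $\mathcal{Q}(G^{k,k/2})$) with real eigenvector $x$, and suppose $\lambda\neq 0$ in the adjacency case (respectively, $\lambda\notin\{d_{\mathbf{u}}:u\in V(G)\}$ in the signless Laplacian case). Let $\mathbf{U}$ be the union of all half edges $\mathbf{u}$ with $|x_{\mathbf{u}}|>0$, and let $U=\{u\in V(G): \mathbf{u}\subseteq\mathbf{U}\}$. Then: (1) the sub-hypergraph of $G^{k,k/2}$ induced by $\mathbf{U}$ contains no isolated half edges (every half edge contained in $\mathbf{U}$ lies in a $k$-element edge of $G^{k,k/2}$ contained in $\mathbf{U}$), and hence the induced subgraph $G[U]$ contains no isolated vertices; (2) $\lambda$ is an $H$-eigenvalue of the principal subtensor $\mathcal{A}(G^{k,k/2})[\mathbf{U}]$ (respectively, $\mathcal{Q}(G^{k,k/2})[\mathbf{U}]$) with eigenvector $\bar{x}:=x[\mathbf{U}]$, the restriction of $x$ to $\mathbf{U}$; (3) $\lambda$ is an eigenvalue of the adjacency matrix $A(G[U])$ (respectively, of the matrix $Q(G)[U]$, the signless Laplacian matrix of the modified induced subgraph $G^{\circ}[U]$) with eigenvector $y$ given by $y_u=\bar{x}^{\mathbf{u}}$ for each $u\in U$.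
   Context: For a simple graph $G$ possibly with loops (edges consisting of one vertex) and even $k\ge 4$, $G^{k,k/2}$ is the hypergraph obtained by replacing each vertex $v$ by a set $\mathbf{v}$ of $k/2$ new vertices (pairwise disjoint, called half edges), each edge $\{u,v\}$ ($u\ne v$) by the $k$-edge $\mathbf{u}\cup\mathbf{v}$, and each loop $\{u\}$ by the loop $\mathbf{u}$. The degree of a vertex is the number of edges (loops included) containing it; $d_{\mathbf{u}}$ is the common degree of the vertices of $\mathbf{u}$. $\mathcal{A}(G^{k,k/2})$ is the order-$k$ tensor indexed by the vertices, with entry $1/(k-1)!$ at $(w_1,\dots,w_k)$ whenever $\{w_1,\dots,w_k\}$ is a $k$-element edge, $0$ otherwise (loops ignored); $\mathcal{Q}=\mathcal{D}+\mathcal{A}$ with $\mathcal{D}$ the diagonal tensor of degrees. $\lambda$ is an eigenvalue of an order-$k$ tensor $\mathcal{T}$ with eigenvector $x\neq0$ if $\sum_{i_2,\dots,i_k}t_{ii_2\dots i_k}x_{i_2}\cdots x_{i_k}=\lambda x_i^{k-1}$ for all $i$; an $H$-eigenvalue if $x$ can be taken real. For a set $S$ of indices, the principal subtensor $\mathcal{T}[S]$ consists of the entries $t_{i_1\dots i_k}$ with all $i_j\in S$, and $x[S]$ is the subvector of $x$ indexed by $S$. Under the hypotheses, all entries of $x$ on a half edge $\mathbf{u}$ have the same modulus, denoted $|x_{\mathbf{u}}|$. For a vertex set $S$, $x^S:=\prod_{w\in S}x_w$. For the graph $G$, $A(G)$ is its adjacency matrix (loops ignored), $Q(G)=D(G)+A(G)$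 with $D(G)$ the diagonal matrix of degrees (each loop counting $1$), $G[U]$ is the subgraph induced by $U$, $Q(G)[U]$ is the principal submatrix of $Q(G)$ indexed by $U$, and the modified induced subgraph $G^{\circ}[U]$ is $G[U]$ together with $d_v(G)-d_v(G[U])$ extra loops at each $v\in U$, so that $Q(G^{\circ}[U])=Q(G)[U]$. *)

theory Defs
  imports Complex_Main "HOL-Library.Multiset" "HOL-Library.FuncSet"
begin

text \<open>The edges form a multiset because the modified induced subgraph may carry several loops
  at the same vertex. Graphs are hypergraphs whose edges have two elements, or one (loops).\<close>

record 'v hypergraph =
  verts :: "'v set"
  edges :: "'v set multiset"

definition simple_graph_with_loops :: "'v hypergraph \<Rightarrow> bool" where
  "simple_graph_with_loops G \<longleftrightarrow>
     finite (verts G) \<and>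
     (\<forall>e \<in># edges G. e \<subseteq> verts G \<and> (card e = 1 \<or> card e = 2 \<and> count (edges G) e = 1))"

definition degree :: "'v hypergraph \<Rightarrow> 'v \<Rightarrow> nat" where
  "degree H v = size {#e \<in># edges H. v \<in> e#}"

definition induced :: "'v hypergraph \<Rightarrow> 'v set \<Rightarrow> 'v hypergraph" where
  "induced H S = \<lparr>verts = verts H \<inter> S, edges = {#e \<in># edges H. e \<subseteq> S#}\<rparr>"

definition modified_induced :: "'v hypergraph \<Rightarrow> 'v set \<Rightarrow> 'v hypergraph" where
  "modified_induced G U =
     \<lparr>verts = verts (induced G U),
      edges = edges (induced G U)
        + (\<Sum>v \<in> verts (induced G U). replicate_mset (degree G v - degree (induced G U) v) {v})\<rparr>"

definition half_edge :: "nat \<Rightarrow> 'v \<Rightarrow> ('v \<times> nat) set" where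
  "half_edge k u = {u} \<times> {..<k div 2}"

text \<open>This is the hypergraph \<open>G\<close> with superscript \<open>k,k/2\<close>: the edge \<open>{u,v}\<close> becomes the union of
  the half edges of \<open>u\<close> and \<open>v\<close>, and the loop \<open>{u}\<close> becomes the half edge of \<open>u\<close>.\<close>

definition half_edge_hypergraph :: "nat \<Rightarrow> 'v hypergraph \<Rightarrow> ('v \<times> nat) hypergraph" where
  "half_edge_hypergraph k G =
     \<lparr>verts = (\<Union>u \<in> verts G. half_edge k u),
      edges = image_mset (\<lambda>e. \<Union>u \<in> e. half_edge k u) (edges G)\<rparr>"

text \<open>Meaningful only when \<open>f\<close> is constant on the nonempty set \<open>S\<close>.\<close>

definition common_value :: "('i \<Rightarrow> 'b) \<Rightarrow> 'i set \<Rightarrow> 'b" where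
  "common_value f S = (THE c. \<forall>w \<in> S. f w = c)"

lemma common_value_eqI:
  assumes "w \<in> S" "\<And>v. v \<in> S \<Longrightarrow> f v = c"
  shows "common_value f S = c"
  unfolding common_value_def using assms by (intro the_equality) auto

definition half_edge_degree :: "nat \<Rightarrow> 'v hypergraph \<Rightarrow> 'v \<Rightarrow> nat" where
  "half_edge_degree k G u = common_value (degree (half_edge_hypergraph k G)) (half_edge k u)"

definition half_edge_modulus :: "nat \<Rightarrow> ('v \<times> nat \<Rightarrow> complex) \<Rightarrow> 'v \<Rightarrow> real" where
  "half_edge_modulus k x u = common_value (\<lambda>w. cmod (x w)) (half_edge k u)"

definition support_half_edges ::
    "nat \<Rightarrow> 'v hypergraph \<Rightarrow> ('v \<times> nat \<Rightarrow> complex) \<Rightarrow> ('v \<times> nat) set" where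
  "support_half_edges k G x = (\<Union>u \<in> {u \<in> verts G. half_edge_modulus k x u > 0}. half_edge k u)"

definition support_verts :: "nat \<Rightarrow> 'v hypergraph \<Rightarrow> ('v \<times> nat \<Rightarrow> complex) \<Rightarrow> 'v set" where
  "support_verts k G x = {u \<in> verts G. half_edge k u \<subseteq> support_half_edges k G x}"

text \<open>A tensor is indexed by lists of length \<open>tensor_order\<close> over the finite set \<open>tensor_index\<close>;
  likewise matrices and vectors are functions considered on an index set.\<close>

record 'i tensor =
  tensor_order :: nat
  tensor_index :: "'i set"
  tensor_entry :: "'i list \<Rightarrow> complex"

definition tensor_eigenpair :: "'i tensor \<Rightarrow> complex \<Rightarrow> ('i \<Rightarrow> complex) \<Rightarrow> bool" where
  "tensor_eigenpair T l x \<longleftrightarrow>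
     (\<exists>i \<in> tensor_index T. x i \<noteq> 0) \<and>
     (\<forall>i \<in> tensor_index T.
        (\<Sum>js \<in> {js. length js = tensor_order T - 1 \<and> set js \<subseteq> tensor_index T}.
           tensor_entry T (i # js) * prod_list (map x js)) = l * x i ^ (tensor_order T - 1))"

definition H_eigenpair :: "'i tensor \<Rightarrow> complex \<Rightarrow> ('i \<Rightarrow> complex) \<Rightarrow> bool" where
  "H_eigenpair T l x \<longleftrightarrow> tensor_eigenpair T l x \<and> (\<forall>i \<in> tensor_index T. x i \<in> \<real>)"

definition principal_subtensor :: "'i tensor \<Rightarrow> 'i set \<Rightarrow> 'i tensor" where
  "principal_subtensor T S =
     \<lparr>tensor_order = tensor_order T, tensor_index = tensor_index T \<inter> S,
      tensor_entry = (\<lambda>is. if set is \<subseteq> S then tensor_entry T is else 0)\<rparr>"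

definition adjacency_tensor :: "nat \<Rightarrow> 'v hypergraph \<Rightarrow> 'v tensor" where
  "adjacency_tensor k H =
     \<lparr>tensor_order = k, tensor_index = verts H,
      tensor_entry = (\<lambda>ws. if card (set ws) = k \<and> set ws \<in># edges H then 1 / fact (k - 1) else 0)\<rparr>"

definition degree_tensor :: "nat \<Rightarrow> 'v hypergraph \<Rightarrow> 'v tensor" where
  "degree_tensor k H =
     \<lparr>tensor_order = k, tensor_index = verts H,
      tensor_entry = (\<lambda>ws. if set ws = {hd ws} then of_nat (degree H (hd ws)) else 0)\<rparr>"

definition signless_laplacian_tensor :: "nat \<Rightarrow> 'v hypergraph \<Rightarrow> 'v tensor" where
  "signless_laplacian_tensor k H =
     \<lparr>tensor_order = k, tensor_index = verts H,
      tensor_entry = (\<lambda>ws. tensor_entry (degree_tensor k H) ws + tensor_entry (adjacency_tensor k H) ws)\<rparr>"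

record 'i matrix =
  matrix_index :: "'i set"
  matrix_entry :: "'i \<Rightarrow> 'i \<Rightarrow> complex"

definition matrix_eigenpair :: "'i matrix \<Rightarrow> complex \<Rightarrow> ('i \<Rightarrow> complex) \<Rightarrow> bool" where
  "matrix_eigenpair M l y \<longleftrightarrow>
     (\<exists>i \<in> matrix_index M. y i \<noteq> 0) \<and>
     (\<forall>i \<in> matrix_index M. (\<Sum>j \<in> matrix_index M. matrix_entry M i j * y j) = l * y i)"

text \<open>Entries outside the index set are set to 0 so that equality of matrices is equality on
  the index set for the matrices considered here.\<close>

definition principal_submatrix :: "'i matrix \<Rightarrow> 'i set \<Rightarrow> 'i matrix" where
  "principal_submatrix M S =
     \<lparr>matrix_index = matrix_index M \<inter> S,
      matrix_entry = (\<lambda>i j. if i \<in> S \<and> j \<in> S then matrix_entry M i j else 0)\<rparr>"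

definition adjacency_matrix :: "'v hypergraph \<Rightarrow> 'v matrix" where
  "adjacency_matrix G =
     \<lparr>matrix_index = verts G,
      matrix_entry = (\<lambda>u v. if u \<noteq> v \<and> {u, v} \<in># edges G then 1 else 0)\<rparr>"

definition degree_matrix :: "'v hypergraph \<Rightarrow> 'v matrix" where
  "degree_matrix G =
     \<lparr>matrix_index = verts G,
      matrix_entry = (\<lambda>u v. if u = v then of_nat (degree G u) else 0)\<rparr>"

definition signless_laplacian_matrix :: "'v hypergraph \<Rightarrow> 'v matrix" where
  "signless_laplacian_matrix G =
     \<lparr>matrix_index = verts G,
      matrix_entry = (\<lambda>u v. matrix_entry (degree_matrix G) u v + matrix_entry (adjacency_matrix G) u v)\<rparr>"

text \<open>Loops do not prevent a half edge or a vertex from being isolated.\<close>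

definition no_isolated_half_edges :: "nat \<Rightarrow> 'v hypergraph \<Rightarrow> ('v \<times> nat) set \<Rightarrow> bool" where
  "no_isolated_half_edges k G S \<longleftrightarrow>
     (\<forall>u \<in> verts G. half_edge k u \<subseteq> S \<longrightarrow>
        (\<exists>e \<in># edges (induced (half_edge_hypergraph k G) S). card e = k \<and> half_edge k u \<subseteq> e))"

definition no_isolated_vertices :: "'v hypergraph \<Rightarrow> bool" where
  "no_isolated_vertices G \<longleftrightarrow> (\<forall>u \<in> verts G. \<exists>e \<in># edges G. card e = 2 \<and> u \<in> e)"

end

theory Submission
  imports Defs "HOL-Combinatorics.Multiset_Permutations"
begin

text \<open>Multiplying the eigenvalue equation at a vertex \<open>w\<close> of the half edge of \<open>u\<close> by \<open>x\<^sub>w\<close> gives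
  \<open>P\<^sub>u S\<^sub>u = (\<lambda> - c\<^sub>u) x\<^sub>w\<^sup>k\<close>, where \<open>P\<^sub>u\<close> is the product of \<open>x\<close> over that half edge, \<open>S\<^sub>u\<close> is the sum
  of \<open>P\<^sub>v\<close> over the neighbours \<open>v\<close> of \<open>u\<close>, and \<open>c\<^sub>u\<close> is \<open>0\<close> or the degree of \<open>u\<close>. As the left hand side
  does not depend on \<open>w\<close>, neither does \<open>\<bar>x\<^sub>w\<bar>\<close>; as \<open>x\<close> is real and \<open>k\<close> is even, \<open>x\<^sub>w\<^sup>k = P\<^sub>u\<^sup>2\<close>. Hence
  \<open>S\<^sub>u = (\<lambda> - c\<^sub>u) P\<^sub>u\<close> wherever \<open>P\<^sub>u \<noteq> 0\<close>, and this is the matrix equation.\<close>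

section \<open>Tensor sums\<close>

lemma finite_index_lists: "finite A \<Longrightarrow> finite {js. length js = n \<and> set js \<subseteq> A}"
  using finite_lists_length_eq[of A n] by (simp add: conj_commute)

text \<open>The tuples \<open>js\<close> for which \<open>w # js\<close> spells a fixed
  \<open>k\<close>-edge \<open>e\<close> are the orderings of \<open>e - {w}\<close>. There are
  \<open>fact (k - 1)\<close> of them, all with the same summand, and their number cancels the
  denominator of the entry.\<close>

lemma adjacency_tensor_sum:
  fixes x :: "'i \<Rightarrow> complex"
  assumes "finite (verts H)" and sub: "\<forall>e\<in>#edges H. e \<subseteq> verts H" and "k > 0"
  shows "(\<Sum>js \<in> {js. length js = k - 1 \<and> set js \<subseteq> verts H}.
            tensor_entry (adjacency_tensor k H) (w # js) * prod_list (map x js)) =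
         (\<Sum>e | e \<in># edges H \<and> card e = k \<and> w \<in> e. \<Prod>v\<in>e - {w}. x v)"
    (is "?lhs = sum ?g ?E")
proof -
  let ?J = "{js. length js = k - 1 \<and> set js \<subseteq> verts H}"
  let ?f = "\<lambda>js. tensor_entry (adjacency_tensor k H) (w # js) * prod_list (map x js)"
  have finE: "finite ?E" by (rule finite_subset[of _ "set_mset (edges H)"]) auto
  have fin: "finite e" if "e \<in> ?E" for e
    using that sub assms(1) finite_subset by blast
  have perm: "{js \<in> ?J. card (set (w # js)) = k \<and> set (w # js) = e} = permutations_of_set (e - {w})"
    if e: "e \<in> ?E" for e
  proof (intro set_eqI iffI)
    fix js assume js: "js \<in> {js \<in> ?J. card (set (w # js)) = k \<and> set (w # js) = e}"
    then have "length js = k - 1" "card (set (w # js)) = k" by blast+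
    \<comment> \<open>Since \<open>k > 0\<close>, the list \<open>w # js\<close> has exactly
      \<open>k\<close> positions. Having \<open>k\<close> distinct values as well, it can repeat
      nothing.\<close>
    then have "card (insert w (set js)) = Suc (length js)" using assms(3) by simp
    then have "card (set js) = length js \<and> w \<notin> set js"
      using card_length[of js] by (auto simp: card_insert_if split: if_splits)
    then show "js \<in> permutations_of_set (e - {w})"
      using js by (auto simp: permutations_of_set_def card_distinct)
  next
    fix js assume js: "js \<in> permutations_of_set (e - {w})"
    have "length js = k - 1"
      using js e fin[OF e] by (auto simp: length_finite_permutations_of_set)
    with js e sub show "js \<in> {js \<in> ?J. card (set (w # js)) = k \<and> set (w # js) = e}"
      by (fastforce simp: permutations_of_set_def insert_absorb)
  qed
  let ?J' = "{js \<in> ?J. card (set (w # js)) = k \<and> set (w # js) \<in># edges H}"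
  have "?lhs = sum ?f ?J'"
    by (rule sum.mono_neutral_right)
      (auto simp: adjacency_tensor_def intro!: finite_index_lists assms(1))
  \<comment> \<open>The surviving tuples are grouped by the edge that they spell together with
    \<open>w\<close>.\<close>
  also have "\<dots> = (\<Sum>e\<in>?E. sum ?f {js \<in> ?J'. set (w # js) = e})"
    by (rule sum.group[symmetric])
      (auto intro: finite_subset[OF _ finite_index_lists[OF assms(1), of "k - 1"]] simp: finE)
  also have "\<dots> = sum ?g ?E"
  proof (rule sum.cong[OF refl])
    fix e assume e: "e \<in> ?E"
    have "{js \<in> ?J'. set (w # js) = e} = permutations_of_set (e - {w})"
      unfolding perm[OF e, symmetric] using e by auto
    moreover have "?f js = ?g e / fact (k - 1)" if "js \<in> permutations_of_set (e - {w})" for js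
    proof -
      from that e have "insert w (set js) = e" "distinct js" "set js = e - {w}"
        by (auto simp: permutations_of_set_def)
      then show ?thesis using e
        by (simp add: adjacency_tensor_def flip: prod.distinct_set_conv_list)
    qed
    ultimately show "sum ?f {js \<in> ?J'. set (w # js) = e} = ?g e"
      using e fin[OF e] by simp
  qed
  finally show ?thesis .
qed

lemma degree_tensor_sum:
  fixes x :: "'i \<Rightarrow> complex"
  assumes "finite (verts H)" and "w \<in> verts H"
  shows "(\<Sum>js \<in> {js. length js = k - 1 \<and> set js \<subseteq> verts H}.
            tensor_entry (degree_tensor k H) (w # js) * prod_list (map x js)) =
         of_nat (degree H w) * x w ^ (k - 1)"
proof -
  \<comment> \<open>A diagonal entry in the row of \<open>w\<close> survives only at the constant
    tuple.\<close>
  have "insert w (set js) = {w} \<longleftrightarrow> js = replicate (k - 1) w" if "length js = k - 1" for js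
    using that by (auto simp: set_replicate_conv_if intro!: replicate_eqI split: if_splits)
  then have "(\<Sum>js \<in> {js. length js = k - 1 \<and> set js \<subseteq> verts H}.
            tensor_entry (degree_tensor k H) (w # js) * prod_list (map x js)) =
         (\<Sum>js \<in> {replicate (k - 1) w}. of_nat (degree H w) * prod_list (map x js))"
    using assms
    by (intro sum.mono_neutral_cong_right) (auto simp: degree_tensor_def intro!: finite_index_lists)
  also have "\<dots> = of_nat (degree H w) * x w ^ (k - 1)"
    by simp
  finally show ?thesis .
qed

lemma signless_laplacian_tensor_sum:
  fixes x :: "'i \<Rightarrow> complex"
  assumes "finite (verts H)" "\<forall>e\<in>#edges H. e \<subseteq> verts H" "k > 0" "w \<in> verts H"
  shows "(\<Sum>js \<in> {js. length js = k - 1 \<and> set js \<subseteq> verts H}.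
            tensor_entry (signless_laplacian_tensor k H) (w # js) * prod_list (map x js)) =
         of_nat (degree H w) * x w ^ (k - 1) +
         (\<Sum>e | e \<in># edges H \<and> card e = k \<and> w \<in> e. \<Prod>v\<in>e - {w}. x v)"
  unfolding adjacency_tensor_sum[OF assms(1,2,3), symmetric] degree_tensor_sum[OF assms(1,4), symmetric]
  by (simp add: signless_laplacian_tensor_def distrib_right sum.distrib)

text \<open>A tuple that leaves \<open>S\<close> has a vanishing factor, so discarding it changes no
  equation at an index in \<open>S\<close>. The nonzero entry required of an eigenvector lies in
  \<open>S\<close> for the same reason.\<close>

lemma H_eigenpair_principal_subtensor:
  assumes eig: "H_eigenpair T l x" and fin: "finite (tensor_index T)"
    and zero: "\<And>i. i \<in> tensor_index T \<Longrightarrow> i \<notin> S \<Longrightarrow> x i = 0"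
  shows "H_eigenpair (principal_subtensor T S) l (restrict x S)"
proof -
  let ?n = "tensor_order T - 1" and ?I = "tensor_index T"
  let ?sum = "\<lambda>J i. \<Sum>js \<in> J. tensor_entry T (i # js) * prod_list (map x js)"
  have restr: "(\<Sum>js \<in> {js. length js = ?n \<and> set js \<subseteq> ?I \<inter> S}.
        (if set (i # js) \<subseteq> S then tensor_entry T (i # js) else 0) *
          prod_list (map (restrict x S) js)) = ?sum {js. length js = ?n \<and> set js \<subseteq> ?I} i"
    if "i \<in> ?I \<inter> S" for i
  proof (rule sum.mono_neutral_cong_left)
    show "\<forall>js \<in> {js. length js = ?n \<and> set js \<subseteq> ?I} - {js. length js = ?n \<and> set js \<subseteq> ?I \<inter> S}.
        tensor_entry T (i # js) * prod_list (map x js) = 0"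
      using zero by (auto simp: prod_list_zero_iff image_iff)
    \<comment> \<open>Outside \<open>S\<close> the restricted vector is \<open>undefined\<close>
      rather than 0. Only tuples inside \<open>S\<close> are compared, where it agrees with
      \<open>x\<close>.\<close>
    fix js assume "js \<in> {js. length js = ?n \<and> set js \<subseteq> ?I \<inter> S}"
    then have "map (restrict x S) js = map x js" "set (i # js) \<subseteq> S"
      using that by (auto simp: restrict_def)
    then show "(if set (i # js) \<subseteq> S then tensor_entry T (i # js) else 0) *
        prod_list (map (restrict x S) js) = tensor_entry T (i # js) * prod_list (map x js)"
      by (simp only: if_True)
  qed (auto intro!: finite_index_lists fin)
  show ?thesis
    unfolding H_eigenpair_def tensor_eigenpair_def
  proof (intro conjI ballI)
    show "\<exists>i\<in>tensor_index (principal_subtensor T S). restrict x S i \<noteq> 0"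
      using eig zero
      by (auto simp: principal_subtensor_def H_eigenpair_def tensor_eigenpair_def)
  next
    fix i assume "i \<in> tensor_index (principal_subtensor T S)"
    then have i: "i \<in> ?I \<inter> S" by (simp add: principal_subtensor_def)
    then show "restrict x S i \<in> \<real>"
      using eig by (simp add: H_eigenpair_def)
    from i restr[OF i] eig
    show "(\<Sum>js \<in> {js. length js = tensor_order (principal_subtensor T S) - 1 \<and>
              set js \<subseteq> tensor_index (principal_subtensor T S)}.
            tensor_entry (principal_subtensor T S) (i # js) * prod_list (map (restrict x S) js)) =
          l * restrict x S i ^ (tensor_order (principal_subtensor T S) - 1)"
      by (simp add: principal_subtensor_def H_eigenpair_def tensor_eigenpair_def)
  qed
qed

section \<open>Half edges\<close>

lemma mem_half_edge [simp]: "(v, i) \<in> half_edge k u \<longleftrightarrow> v = u \<and> i < k div 2"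
  by (auto simp: half_edge_def)

lemma finite_half_edge [simp]: "finite (half_edge k u)"
  by (simp add: half_edge_def)

lemma card_half_edge [simp]: "card (half_edge k u) = k div 2"
  by (simp add: half_edge_def)

lemma disjoint_half_edges: "u \<noteq> v \<Longrightarrow> half_edge k u \<inter> half_edge k v = {}"
  by (auto simp: half_edge_def)

lemma verts_half_edge_hypergraph [simp]:
  "(v, i) \<in> verts (half_edge_hypergraph k G) \<longleftrightarrow> v \<in> verts G \<and> i < k div 2"
  by (auto simp: half_edge_hypergraph_def)

lemma finite_verts_half_edge_hypergraph:
  "simple_graph_with_loops G \<Longrightarrow> finite (verts (half_edge_hypergraph k G))"
  by (simp add: half_edge_hypergraph_def simple_graph_with_loops_def)

lemma edge_half_edge_hypergraph_subset:
  assumes "simple_graph_with_loops G"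
  shows "\<forall>e\<in>#edges (half_edge_hypergraph k G). e \<subseteq> verts (half_edge_hypergraph k G)"
  using assms by (fastforce simp: half_edge_hypergraph_def simple_graph_with_loops_def)

lemma degree_half_edge_hypergraph:
  assumes "i < k div 2"
  shows "degree (half_edge_hypergraph k G) (u, i) = degree G u"
  using assms
  by (simp add: degree_def half_edge_hypergraph_def filter_mset_image_mset)

lemma half_edge_degree_eq:
  assumes "k \<ge> 2"
  shows "half_edge_degree k G u = degree G u"
  unfolding half_edge_degree_def using assms
  \<comment> \<open>The vertex \<open>(u, 0)\<close> exists because \<open>k \<ge> 2\<close>. It
    makes the half edge nonempty, so the common value is determined.\<close>
  by (intro common_value_eqI[of "(u, 0)"]) (auto simp: degree_half_edge_hypergraph)

text \<open>Loops are left out because they yield no \<open>k\<close>-edge and no adjacency entry.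
  This set therefore indexes both the tensor sums and the matrix rows.\<close>

definition neighbours :: "'v hypergraph \<Rightarrow> 'v \<Rightarrow> 'v set" where
  "neighbours G u = {v \<in> verts G. u \<noteq> v \<and> {u, v} \<in># edges G}"

text \<open>Two disjoint half edges have \<open>k\<close> vertices together because \<open>k\<close>
  is even, whereas the image of a loop has only \<open>k div 2\<close>. The cardinality condition
  thus selects the images of the two-element edges at \<open>u\<close>.\<close>

lemma k_edges_half_edge_hypergraph:
  assumes "k \<ge> 2" "even k" "simple_graph_with_loops G" "i < k div 2"
  shows "bij_betw (\<lambda>v. half_edge k u \<union> half_edge k v) (neighbours G u)
    {e. e \<in># edges (half_edge_hypergraph k G) \<and> card e = k \<and> (u, i) \<in> e}"
proof (rule bij_betw_imageI)
  show "inj_on (\<lambda>v. half_edge k u \<union> half_edge k v) (neighbours G u)"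
  proof (rule inj_onI)
    fix v w assume "v \<in> neighbours G u" "w \<in> neighbours G u"
      and eq: "half_edge k u \<union> half_edge k v = half_edge k u \<union> half_edge k w"
    \<comment> \<open>The vertex \<open>(v, i)\<close> lies in the second union but not over
      \<open>u\<close>, which forces \<open>v = w\<close>.\<close>
    moreover have "(v, i) \<in> half_edge k u \<union> half_edge k w"
      using assms(4) by (simp flip: eq)
    ultimately show "v = w" by (auto simp: neighbours_def)
  qed
  show "(\<lambda>v. half_edge k u \<union> half_edge k v) ` neighbours G u =
    {e. e \<in># edges (half_edge_hypergraph k G) \<and> card e = k \<and> (u, i) \<in> e}"
  proof (intro equalityI subsetI)
    fix e assume "e \<in> (\<lambda>v. half_edge k u \<union> half_edge k v) ` neighbours G u"
    then obtain v where v: "u \<noteq> v" "{u, v} \<in># edges G" and e: "e = half_edge k u \<union> half_edge k v"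
      by (auto simp: neighbours_def)
    have "e \<in> (\<lambda>f. \<Union>w\<in>f. half_edge k w) ` set_mset (edges G)"
      using v(2) by (intro image_eqI[of _ _ "{u, v}"]) (auto simp: e)
    then have "e \<in># edges (half_edge_hypergraph k G)"
      by (simp add: half_edge_hypergraph_def)
    moreover have "card e = k"
      using e assms(2) by (auto simp: card_Un_disjoint disjoint_half_edges[OF v(1)] elim!: evenE)
    ultimately show "e \<in> {e. e \<in># edges (half_edge_hypergraph k G) \<and> card e = k \<and> (u, i) \<in> e}"
      using e assms(4) by simp
  next
    fix e assume "e \<in> {e. e \<in># edges (half_edge_hypergraph k G) \<and> card e = k \<and> (u, i) \<in> e}"
    then obtain f where f: "f \<in># edges G" and e: "e = (\<Union>w\<in>f. half_edge k w)"
      and card: "card e = k" and u: "u \<in> f"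
      by (auto simp: half_edge_hypergraph_def)
    have "card f \<noteq> 1"
      using e card assms(1,2) by (auto simp: card_1_singleton_iff)
    then have "card f = 2" and sub: "f \<subseteq> verts G"
      using f assms(3) by (auto simp: simple_graph_with_loops_def)
    then obtain v where "f = {u, v}" "u \<noteq> v"
      using u by (auto simp: card_2_iff)
    with f e sub show "e \<in> (\<lambda>v. half_edge k u \<union> half_edge k v) ` neighbours G u"
      by (auto simp: neighbours_def)
  qed
qed

text \<open>Disjointness of half edges splits each product. The factor from the punctured half edge
  of \<open>u\<close> is the same for every neighbour and leaves the sum.\<close>

lemma sum_k_edges_half_edge_hypergraph:
  fixes x :: "'v \<times> nat \<Rightarrow> complex"
  assumes "k \<ge> 2" "even k" "simple_graph_with_loops G" "i < k div 2"
  shows "(\<Sum>e | e \<in># edges (half_edge_hypergraph k G) \<and> card e = k \<and> (u, i) \<in> e.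
            \<Prod>w\<in>e - {(u, i)}. x w) =
         prod x (half_edge k u - {(u, i)}) * (\<Sum>v\<in>neighbours G u. prod x (half_edge k v))"
proof -
  have "(\<Prod>w\<in>half_edge k u \<union> half_edge k v - {(u, i)}. x w) =
      prod x (half_edge k u - {(u, i)}) * prod x (half_edge k v)"
    if "v \<in> neighbours G u" for v
  proof -
    have "u \<noteq> v" using that by (simp add: neighbours_def)
    then have "half_edge k u \<union> half_edge k v - {(u, i)} =
        (half_edge k u - {(u, i)}) \<union> half_edge k v"
      "(half_edge k u - {(u, i)}) \<inter> half_edge k v = {}"
      by (auto simp: half_edge_def)
    then show ?thesis by (simp add: prod.union_disjoint)
  qed
  then show ?thesis
    by (simp add: sum_distrib_left flip: sum.reindex_bij_betw[OF k_edges_half_edge_hypergraph[OF assms]])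
qed

section \<open>The support of an eigenvector\<close>

text \<open>The tensor enters only through the evaluated equation \<open>eq\<close>, so a free
  diagonal coefficient \<open>c u\<close> serves the adjacency and the signless Laplacian case
  alike. The conclusions replace moduli by nonvanishing of entries and of half edge
  products.\<close>

lemma support_eigenvector:
  fixes x :: "'v \<times> nat \<Rightarrow> complex" and c :: "'v \<Rightarrow> complex"
  assumes k: "k \<ge> 2" "even k" and G: "simple_graph_with_loops G"
    and real: "\<forall>u\<in>verts G. \<forall>i<k div 2. x (u, i) \<in> \<real>"
    and eq: "\<forall>u\<in>verts G. \<forall>i<k div 2.
      c u * x (u, i) ^ (k - 1) +
      (\<Sum>e | e \<in># edges (half_edge_hypergraph k G) \<and> card e = k \<and> (u, i) \<in> e.
         \<Prod>w\<in>e - {(u, i)}. x w) = l * x (u, i) ^ (k - 1)"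
    and l: "\<forall>u\<in>verts G. l \<noteq> c u"
  shows support_half_edges_eq:
      "support_half_edges k G x = {w \<in> verts (half_edge_hypergraph k G). x w \<noteq> 0}" (is ?t1)
    and support_verts_eq:
      "support_verts k G x = {u \<in> verts G. prod x (half_edge k u) \<noteq> 0}" (is ?t2)
    and support_neighbour_sum: "\<And>u. u \<in> support_verts k G x \<Longrightarrow>
      (\<Sum>v\<in>neighbours G u \<inter> support_verts k G x. prod x (half_edge k v)) =
      (l - c u) * prod x (half_edge k u)" (is "\<And>u. _ \<Longrightarrow> ?t3 u")
    and support_half_edges_subset_iff: "\<And>u. u \<in> verts G \<Longrightarrow>
      half_edge k u \<subseteq> support_half_edges k G x \<longleftrightarrow> u \<in> support_verts k G x"
proof -
  note real = real[rule_format] and eq = eq[rule_format] and l = l[rule_format]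
  let ?P = "\<lambda>u. prod x (half_edge k u)"
  define S where "S u = (\<Sum>v\<in>neighbours G u. ?P v)" for u
  \<comment> \<open>Multiplication by \<open>x (u, i)\<close> completes the punctured product to
    \<open>?P u\<close>. Nothing is divided, so the identity also covers vanishing entries.\<close>
  have key: "?P u * S u = (l - c u) * x (u, i) ^ k" if "u \<in> verts G" "i < k div 2" for u i
  proof -
    have "?P u * S u = x (u, i) * (prod x (half_edge k u - {(u, i)}) * S u)"
      using that by (subst prod.remove[of _ "(u, i)"]) auto
    also have "prod x (half_edge k u - {(u, i)}) * S u = (l - c u) * x (u, i) ^ (k - 1)"
      using eq[OF that] sum_k_edges_half_edge_hypergraph[OF k G that(2)]
      by (simp add: S_def algebra_simps)
    also have "x (u, i) * ((l - c u) * x (u, i) ^ (k - 1)) = (l - c u) * x (u, i) ^ k"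
      using k(1) by (simp add: mult.left_commute flip: power_Suc)
    finally show ?thesis .
  qed
  \<comment> \<open>The nonzero factor \<open>l - c u\<close> cancels between two instances of
    \<open>key\<close>.\<close>
  have pow: "x (u, i) ^ k = x (u, j) ^ k" if "u \<in> verts G" "i < k div 2" "j < k div 2" for u i j
    using key[OF that(1,2)] key[OF that(1,3)] l[OF that(1)] by simp
  have mod: "cmod (x (u, i)) = cmod (x (u, j))"
    if "u \<in> verts G" "i < k div 2" "j < k div 2" for u i j
    using arg_cong[OF pow[OF that], of cmod] k(1)
    by (auto simp: norm_power intro: power_eq_imp_eq_base)
  \<comment> \<open>Real entries of equal modulus differ at most by sign, so their squares agree.
    Squaring the product of \<open>k div 2\<close> entries removes all signs.\<close>
  have square: "?P u ^ 2 = x (u, i) ^ k" if u: "u \<in> verts G" and i: "i < k div 2" for u i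
  proof -
    have "x w ^ 2 = x (u, i) ^ 2" if w: "w \<in> half_edge k u" for w
    proof -
      obtain j where j: "w = (u, j)" "j < k div 2" using w by (cases w) auto
      from real[OF u i] real[OF u j(2)] obtain a b where
        "x (u, i) = of_real a" "x (u, j) = of_real b" by (auto elim!: Reals_cases)
      with mod[OF u i j(2)] have "x (u, j) = x (u, i) \<or> x (u, j) = - x (u, i)"
        by (auto simp: abs_eq_iff)
      with j(1) show ?thesis by (simp add: power2_eq_iff)
    qed
    then have "?P u ^ 2 = (\<Prod>w\<in>half_edge k u. x (u, i) ^ 2)"
      by (simp add: prod_power_distrib)
    also have "\<dots> = x (u, i) ^ (2 * (k div 2))"
      by (simp add: power_mult)
    finally show ?thesis using k(2) by simp
  qed
  have nz: "?P u \<noteq> 0 \<longleftrightarrow> x (u, i) \<noteq> 0" if "u \<in> verts G" "i < k div 2" for u i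
  proof -
    have "?P u ^ 2 = 0 \<longleftrightarrow> x (u, i) ^ k = 0" by (simp only: square[OF that])
    then show ?thesis using k(1) by simp
  qed
  have k0: "0 < k div 2" using k(1) by simp
  \<comment> \<open>By \<open>mod\<close> the modulus is constant on the half edge, which
    \<open>k0\<close> makes nonempty, so it can be read off at \<open>(u, 0)\<close>.\<close>
  have modulus: "half_edge_modulus k x u > 0 \<longleftrightarrow> ?P u \<noteq> 0" if u: "u \<in> verts G" for u
  proof -
    have "half_edge_modulus k x u = cmod (x (u, 0))"
      unfolding half_edge_modulus_def
    proof (rule common_value_eqI[of "(u, 0)"])
      fix v assume "v \<in> half_edge k u"
      then obtain j where "v = (u, j)" "j < k div 2" by (cases v) auto
      with mod[OF u _ k0] show "cmod (x v) = cmod (x (u, 0))" by blast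
    qed (use k0 in simp)
    then show ?thesis using nz[OF u k0] by simp
  qed
  show t1: ?t1
  proof (intro set_eqI iffI)
    fix w assume "w \<in> support_half_edges k G x"
    then obtain u i where "w = (u, i)" "i < k div 2" "u \<in> verts G" "half_edge_modulus k x u > 0"
      unfolding support_half_edges_def by (cases w) auto
    with modulus nz show "w \<in> {w \<in> verts (half_edge_hypergraph k G). x w \<noteq> 0}" by simp
  next
    fix w assume "w \<in> {w \<in> verts (half_edge_hypergraph k G). x w \<noteq> 0}"
    then obtain u i where w: "w = (u, i)" "i < k div 2" "u \<in> verts G" "x (u, i) \<noteq> 0"
      by (cases w) auto
    with modulus nz have "half_edge_modulus k x u > 0" by blast
    with w show "w \<in> support_half_edges k G x"
      by (simp add: support_half_edges_def)
  qed
  show "half_edge k u \<subseteq> support_half_edges k G x \<longleftrightarrow> u \<in> support_verts k G x"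
    if "u \<in> verts G" for u using that by (simp add: support_verts_def)
  \<comment> \<open>An empty half edge would be contained vacuously; \<open>k0\<close> rules this
    out.\<close>
  have "half_edge k u \<subseteq> support_half_edges k G x \<longleftrightarrow> ?P u \<noteq> 0" if u: "u \<in> verts G" for u
    unfolding t1 using nz[OF u] u k0 by auto
  then show t2: ?t2 by (auto simp: support_verts_def)
  show "?t3 u" if "u \<in> support_verts k G x" for u
  proof -
    have u: "u \<in> verts G" "?P u \<noteq> 0" using that by (auto simp: t2)
    have "finite (neighbours G u)"
      using G by (simp add: neighbours_def simple_graph_with_loops_def)
    \<comment> \<open>Neighbours outside the support have product 0 and drop out.\<close>
    then have "S u = (\<Sum>v\<in>neighbours G u \<inter> support_verts k G x. ?P v)"
      unfolding S_def by (intro sum.mono_neutral_right) (auto simp: t2 neighbours_def)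
    \<comment> \<open>Writing \<open>x (u, 0) ^ k\<close> as \<open>?P u ^ 2\<close> in
      \<open>key\<close> puts the factor \<open>?P u\<close> on both sides, and it is nonzero on the
      support.\<close>
    moreover have "?P u * S u = ?P u * ((l - c u) * ?P u)"
      using key[OF u(1) k0] square[OF u(1) k0] by (simp add: power2_eq_square)
    ultimately show ?thesis using u(2) by simp
  qed
qed

text \<open>A single supported neighbour \<open>v\<close> of \<open>u\<close> answers both claims:
  the union of the two half edges is the required \<open>k\<close>-edge, and \<open>{u, v}\<close>
  is the required edge of the induced graph.\<close>

lemma no_isolated_support:
  assumes k: "k \<ge> 2" "even k" and G: "simple_graph_with_loops G"
    and nbr: "\<And>u. u \<in> support_verts k G x \<Longrightarrow> neighbours G u \<inter> support_verts k G x \<noteq> {}"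
  shows "no_isolated_half_edges k G (support_half_edges k G x)"
    and "no_isolated_vertices (induced G (support_verts k G x))"
proof -
  have k0: "0 < k div 2" using k(1) by simp
  show "no_isolated_half_edges k G (support_half_edges k G x)"
    unfolding no_isolated_half_edges_def
  proof (intro ballI impI)
    fix u assume u: "u \<in> verts G" "half_edge k u \<subseteq> support_half_edges k G x"
    then have "u \<in> support_verts k G x" by (simp add: support_verts_def)
    then obtain v where v: "v \<in> neighbours G u" "v \<in> support_verts k G x"
      using nbr by blast
    let ?e = "half_edge k u \<union> half_edge k v"
    have "?e \<in># edges (half_edge_hypergraph k G)" "card ?e = k"
      using bij_betwE[OF k_edges_half_edge_hypergraph[OF k G k0]] v(1) by blast+
    moreover have "?e \<subseteq> support_half_edges k G x"
      using u v by (simp add: support_verts_def)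
    ultimately show "\<exists>e \<in># edges (induced (half_edge_hypergraph k G) (support_half_edges k G x)).
        card e = k \<and> half_edge k u \<subseteq> e"
      by (intro bexI[of _ ?e]) (auto simp: induced_def)
  qed
  show "no_isolated_vertices (induced G (support_verts k G x))"
    unfolding no_isolated_vertices_def
  proof
    fix u assume "u \<in> verts (induced G (support_verts k G x))"
    then have u: "u \<in> support_verts k G x" by (simp add: induced_def)
    then obtain v where v: "v \<in> neighbours G u" "v \<in> support_verts k G x"
      using nbr by blast
    with u show "\<exists>e \<in># edges (induced G (support_verts k G x)). card e = 2 \<and> u \<in> e"
      by (intro bexI[of _ "{u, v}"]) (auto simp: induced_def neighbours_def)
  qed
qed

text \<open>The added loops restore the degrees lost by passing to \<open>U\<close> and leave the
  off-diagonal entries alone. Equality is between total functions, so entries outside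
  \<open>U\<close> have to be matched too.\<close>

lemma signless_laplacian_matrix_modified_induced:
  fixes G :: "'v hypergraph"
  assumes "finite (verts G)" "U \<subseteq> verts G"
  shows "signless_laplacian_matrix (modified_induced G U) =
    principal_submatrix (signless_laplacian_matrix G) U"
proof -
  have U: "verts G \<inter> U = U" and fin: "finite U"
    using assms by (auto intro: finite_subset)
  let ?I = "induced G U"
  have vI: "verts ?I = U" by (simp add: induced_def U)
  let ?d = "\<lambda>v. degree G v - degree ?I v"
  \<comment> \<open>This makes the truncated subtraction in \<open>?d\<close> an honest
    difference.\<close>
  have le: "degree ?I v \<le> degree G v" for v
    by (auto simp: degree_def induced_def intro!: size_mset_mono multiset_filter_mono)
  have repl: "filter_mset P (replicate_mset n e) = (if P e then replicate_mset n e else {#})"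
    for P :: "'v set \<Rightarrow> bool" and n e by (induction n) auto
  have extra: "size (filter_mset ((\<in>) v) (\<Sum>u\<in>W. replicate_mset (f u) {u})) =
      (if v \<in> W then f v else 0)" if "finite W" for v W and f :: "'v \<Rightarrow> nat"
    using that by (induction W) (auto simp: repl)
  have deg: "degree (modified_induced G U) v = degree ?I v + (if v \<in> U then ?d v else 0)" for v
    by (simp add: degree_def modified_induced_def vI fin extra del: filter_mset_eq_mempty_iff)
  \<comment> \<open>Outside \<open>U\<close> no edge survives, which matches the zero filling of the
    principal submatrix.\<close>
  have zero: "degree ?I v = 0" if "v \<notin> U" for v
    using that by (auto simp: degree_def induced_def filter_mset_eq_conv)
  have deg': "degree (modified_induced G U) v = (if v \<in> U then degree G v else 0)" for v
    using le[of v] zero[of v] by (simp add: deg)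
  \<comment> \<open>Every added edge is a singleton, so none can create an adjacency between
    distinct vertices.\<close>
  have loop: "\<exists>u. e = {u}" if "finite W" "e \<in># (\<Sum>u\<in>W. replicate_mset (?d u) {u})" for e W
    using that by (induction W) (auto split: if_splits)
  have edge: "{u, v} \<in># edges (modified_induced G U) \<longleftrightarrow>
      {u, v} \<in># edges G \<and> u \<in> U \<and> v \<in> U" if "u \<noteq> v" for u v
  proof -
    have "{u, v} \<notin># (\<Sum>u\<in>U. replicate_mset (?d u) {u})"
    proof
      assume "{u, v} \<in># (\<Sum>u\<in>U. replicate_mset (?d u) {u})"
      from loop[OF fin this] show False using that by auto
    qed
    then have "{u, v} \<in># edges (modified_induced G U) \<longleftrightarrow> {u, v} \<in># edges ?I"
      by (simp only: modified_induced_def vI hypergraph.simps union_iff) simp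
    then show ?thesis by (simp add: induced_def)
  qed
  have vM: "verts (modified_induced G U) = U" by (simp add: modified_induced_def vI)
  show ?thesis
    by (auto simp: signless_laplacian_matrix_def principal_submatrix_def degree_matrix_def
        adjacency_matrix_def deg' edge fun_eq_iff U vM)
qed

section \<open>From the tensor equations to the matrix equations\<close>

theorem theorem3p3:
  fixes G :: "'v hypergraph" and k :: nat and l :: complex and x :: "'v \<times> nat \<Rightarrow> complex"
  assumes "k \<ge> 4" and "even k" and "simple_graph_with_loops G"
  shows
    "(let H = half_edge_hypergraph k G;
          UU = support_half_edges k G x;
          U = support_verts k G x;
          xbar = restrict x UU;
          y = (\<lambda>u\<in>U. \<Prod>w\<in>half_edge k u. xbar w)
      in
        (H_eigenpair (adjacency_tensor k H) l x \<and> l \<noteq> 0 \<longrightarrow>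
           (no_isolated_half_edges k G UU \<and> no_isolated_vertices (induced G U)) \<and>
           H_eigenpair (principal_subtensor (adjacency_tensor k H) UU) l xbar \<and>
           matrix_eigenpair (adjacency_matrix (induced G U)) l y) \<and>
        (H_eigenpair (signless_laplacian_tensor k H) l x \<and>
           l \<notin> {of_nat (half_edge_degree k G u) | u. u \<in> verts G} \<longrightarrow>
           (no_isolated_half_edges k G UU \<and> no_isolated_vertices (induced G U)) \<and>
           H_eigenpair (principal_subtensor (signless_laplacian_tensor k H) UU) l xbar \<and>
           matrix_eigenpair (principal_submatrix (signless_laplacian_matrix G) U) l y \<and>
           signless_laplacian_matrix (modified_induced G U)
             = principal_submatrix (signless_laplacian_matrix G) U))"
proof -
  let ?H = "half_edge_hypergraph k G"
  let ?UU = "support_half_edges k G x" and ?U = "support_verts k G x"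
  let ?P = "\<lambda>u. prod x (half_edge k u)"
  let ?y = "\<lambda>u\<in>?U. \<Prod>w\<in>half_edge k u. restrict x ?UU w"
  have k2: "k \<ge> 2" and k0: "k > 0" using assms(1) by auto
  note k = k2 assms(2)
  note finH = finite_verts_half_edge_hypergraph[OF assms(3), of k]
  note subH = edge_half_edge_hypergraph_subset[OF assms(3), of k]
  \<comment> \<open>For \<open>u\<close> in the support the whole half edge lies in
    \<open>?UU\<close>, where the restriction agrees with \<open>x\<close>.\<close>
  have y: "?y u = ?P u" if "u \<in> ?U" for u
    using that by (auto simp: support_verts_def intro!: prod.cong)
  have finU: "finite ?U" and subU: "?U \<subseteq> verts G"
    using assms(3) by (auto simp: support_verts_def simple_graph_with_loops_def)
  have U: "verts G \<inter> ?U = ?U" using subU by blast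
  \<comment> \<open>Both cases at once: the diagonal part \<open>c\<close> is \<open>0\<close> for the adjacency tensor.\<close>
  have main: "(no_isolated_half_edges k G ?UU \<and> no_isolated_vertices (induced G ?U)) \<and>
      H_eigenpair (principal_subtensor T ?UU) l (restrict x ?UU) \<and>
      (\<exists>u\<in>?U. ?y u \<noteq> 0) \<and>
      (\<forall>u\<in>?U. c u * ?y u + (\<Sum>v\<in>neighbours G u \<inter> ?U. ?y v) = l * ?y u)"
    if eig: "H_eigenpair T l x" and ord: "tensor_order T = k" and ind: "tensor_index T = verts ?H"
      and sum: "\<And>u i. u \<in> verts G \<Longrightarrow> i < k div 2 \<Longrightarrow>
        (\<Sum>js \<in> {js. length js = k - 1 \<and> set js \<subseteq> verts ?H}.
          tensor_entry T ((u, i) # js) * prod_list (map x js)) =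
        c u * x (u, i) ^ (k - 1) +
        (\<Sum>e | e \<in># edges ?H \<and> card e = k \<and> (u, i) \<in> e. \<Prod>w\<in>e - {(u, i)}. x w)"
      and l: "\<And>u. u \<in> verts G \<Longrightarrow> l \<noteq> c u"
    for T c
  proof -
    have real: "\<forall>u\<in>verts G. \<forall>i<k div 2. x (u, i) \<in> \<real>"
      using eig by (auto simp: H_eigenpair_def ind)
    have eq: "\<forall>u\<in>verts G. \<forall>i<k div 2. c u * x (u, i) ^ (k - 1) +
        (\<Sum>e | e \<in># edges ?H \<and> card e = k \<and> (u, i) \<in> e. \<Prod>w\<in>e - {(u, i)}. x w) =
        l * x (u, i) ^ (k - 1)"
    proof (intro ballI allI impI)
      fix u i assume ui: "u \<in> verts G" "i < k div 2"
      then have "(u, i) \<in> verts ?H" by simp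
      with eig show "c u * x (u, i) ^ (k - 1) +
          (\<Sum>e | e \<in># edges ?H \<and> card e = k \<and> (u, i) \<in> e. \<Prod>w\<in>e - {(u, i)}. x w) =
          l * x (u, i) ^ (k - 1)"
        unfolding sum[OF ui, symmetric] H_eigenpair_def tensor_eigenpair_def ind ord by blast
    qed
    have lc: "\<forall>u\<in>verts G. l \<noteq> c u" using l by blast
    note supp = support_eigenvector[OF k assms(3) real eq lc]
    have P: "?P u \<noteq> 0" if "u \<in> ?U" for u using that supp(2) by blast
    \<comment> \<open>Without a supported neighbour the neighbour sum is empty, although it equals
      the product of the nonzero numbers \<open>l - c u\<close> and \<open>?P u\<close>.\<close>
    have nbr: "neighbours G u \<inter> ?U \<noteq> {}" if "u \<in> ?U" for u
    proof
      assume "neighbours G u \<inter> ?U = {}"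
      then have "(l - c u) * ?P u = 0" using supp(3)[OF that] by simp
      then show False using P[OF that] l subU that by auto
    qed
    \<comment> \<open>One nonzero entry of the eigenvector puts its entire half edge into the
      support.\<close>
    have "?U \<noteq> {}"
    proof -
      obtain u i where "(u, i) \<in> verts ?H" "x (u, i) \<noteq> 0"
        using eig by (auto simp: H_eigenpair_def tensor_eigenpair_def ind)
      then have "(u, i) \<in> ?UU" using supp(1) by simp
      then have "half_edge k u \<subseteq> ?UU" "u \<in> verts G"
        by (auto simp: support_half_edges_def half_edge_def)
      then show ?thesis using supp(4) by blast
    qed
    then have "\<exists>u\<in>?U. ?y u \<noteq> 0" using P y by (metis ex_in_conv)
    moreover have "c u * ?y u + (\<Sum>v\<in>neighbours G u \<inter> ?U. ?y v) = l * ?y u" if "u \<in> ?U" for u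
    proof -
      have "(\<Sum>v\<in>neighbours G u \<inter> ?U. ?y v) = (\<Sum>v\<in>neighbours G u \<inter> ?U. ?P v)"
        by (rule sum.cong) (auto simp: y simp del: restrict_apply)
      then show ?thesis
        using supp(3)[OF that] y[OF that] by (simp add: algebra_simps del: restrict_apply)
    qed
    moreover have "H_eigenpair (principal_subtensor T ?UU) l (restrict x ?UU)"
      using supp(1) by (intro H_eigenpair_principal_subtensor eig) (auto simp: ind finH)
    ultimately show ?thesis
      using no_isolated_support[OF k assms(3), of x] nbr by blast
  qed
  have adj: "(\<Sum>v\<in>?U. (if u \<noteq> v \<and> {u, v} \<in># edges G then 1 else 0) * f v) =
      (\<Sum>v\<in>neighbours G u \<inter> ?U. f v)" for u and f :: "'v \<Rightarrow> complex"
    using finU subU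
    by (intro sum.mono_neutral_cong_right) (auto simp: neighbours_def)
  show ?thesis
    unfolding Let_def
  proof (intro conjI[of "_ \<longrightarrow> _"] impI)
    assume asm: "H_eigenpair (adjacency_tensor k ?H) l x \<and> l \<noteq> 0"
    have *: "(no_isolated_half_edges k G ?UU \<and> no_isolated_vertices (induced G ?U)) \<and>
      H_eigenpair (principal_subtensor (adjacency_tensor k ?H) ?UU) l (restrict x ?UU) \<and>
      (\<exists>u\<in>?U. ?y u \<noteq> 0) \<and>
      (\<forall>u\<in>?U. 0 * ?y u + (\<Sum>v\<in>neighbours G u \<inter> ?U. ?y v) = l * ?y u)"
    proof (rule main)
      show "(\<Sum>js \<in> {js. length js = k - 1 \<and> set js \<subseteq> verts ?H}.
          tensor_entry (adjacency_tensor k ?H) ((u, i) # js) * prod_list (map x js)) =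
        0 * x (u, i) ^ (k - 1) +
        (\<Sum>e | e \<in># edges ?H \<and> card e = k \<and> (u, i) \<in> e. \<Prod>w\<in>e - {(u, i)}. x w)" for u i
        unfolding adjacency_tensor_sum[OF finH subH k0] by simp
    qed (use asm in \<open>simp_all add: adjacency_tensor_def\<close>)
    have "(\<Sum>v\<in>?U. matrix_entry (adjacency_matrix (induced G ?U)) u v * ?y v) =
        (\<Sum>v\<in>neighbours G u \<inter> ?U. ?y v)" if "u \<in> ?U" for u
      unfolding adj[symmetric] using that
      by (intro sum.cong) (auto simp: adjacency_matrix_def induced_def)
    moreover have "matrix_index (adjacency_matrix (induced G ?U)) = ?U"
      by (simp add: adjacency_matrix_def induced_def U)
    ultimately have "matrix_eigenpair (adjacency_matrix (induced G ?U)) l ?y"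
      using * by (simp add: matrix_eigenpair_def del: restrict_apply)
    with * show "(no_isolated_half_edges k G ?UU \<and> no_isolated_vertices (induced G ?U)) \<and>
      H_eigenpair (principal_subtensor (adjacency_tensor k ?H) ?UU) l (restrict x ?UU) \<and>
      matrix_eigenpair (adjacency_matrix (induced G ?U)) l ?y" by blast
  next
    assume asm: "H_eigenpair (signless_laplacian_tensor k ?H) l x \<and>
      l \<notin> {of_nat (half_edge_degree k G u) | u. u \<in> verts G}"
    let ?c = "\<lambda>u. of_nat (degree G u) :: complex"
    have *: "(no_isolated_half_edges k G ?UU \<and> no_isolated_vertices (induced G ?U)) \<and>
      H_eigenpair (principal_subtensor (signless_laplacian_tensor k ?H) ?UU) l (restrict x ?UU) \<and>
      (\<exists>u\<in>?U. ?y u \<noteq> 0) \<and>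
      (\<forall>u\<in>?U. ?c u * ?y u + (\<Sum>v\<in>neighbours G u \<inter> ?U. ?y v) = l * ?y u)"
    proof (rule main)
      show "l \<noteq> ?c u" if "u \<in> verts G" for u
        \<comment> \<open>Half edge degrees are the degrees in \<open>G\<close>, so the excluded
          values are exactly the diagonal coefficients.\<close>
        using asm that by (auto simp: half_edge_degree_eq[OF k2])
      show "(\<Sum>js \<in> {js. length js = k - 1 \<and> set js \<subseteq> verts ?H}.
          tensor_entry (signless_laplacian_tensor k ?H) ((u, i) # js) * prod_list (map x js)) =
        ?c u * x (u, i) ^ (k - 1) +
        (\<Sum>e | e \<in># edges ?H \<and> card e = k \<and> (u, i) \<in> e. \<Prod>w\<in>e - {(u, i)}. x w)"
        if "u \<in> verts G" "i < k div 2" for u i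
        using signless_laplacian_tensor_sum[OF finH subH k0, of "(u, i)" x] that
        by (simp only: verts_half_edge_hypergraph degree_half_edge_hypergraph)
    qed (use asm in \<open>simp_all add: signless_laplacian_tensor_def\<close>)
    let ?M = "principal_submatrix (signless_laplacian_matrix G) ?U"
    have "(\<Sum>v\<in>?U. matrix_entry ?M u v * ?y v) =
        ?c u * ?y u + (\<Sum>v\<in>neighbours G u \<inter> ?U. ?y v)" if "u \<in> ?U" for u
    proof -
      \<comment> \<open>The row splits into its diagonal term and the adjacency indicator. Loops
        enter only through the degree on the diagonal.\<close>
      have "(\<Sum>v\<in>?U. matrix_entry ?M u v * ?y v) =
          (\<Sum>v\<in>?U. (if u = v then ?c u * ?y v else 0) +
            (if u \<noteq> v \<and> {u, v} \<in># edges G then 1 else 0) * ?y v)"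
        using that
        by (intro sum.cong) (auto simp: principal_submatrix_def signless_laplacian_matrix_def
            degree_matrix_def adjacency_matrix_def simp del: restrict_apply)
      then show ?thesis
        using that finU by (simp add: sum.distrib adj del: restrict_apply)
    qed
    moreover have "matrix_index ?M = ?U"
      by (simp add: principal_submatrix_def signless_laplacian_matrix_def U)
    ultimately have "matrix_eigenpair ?M l ?y"
      using * by (simp add: matrix_eigenpair_def del: restrict_apply)
    with * signless_laplacian_matrix_modified_induced[OF _ subU] assms(3)
    show "(no_isolated_half_edges k G ?UU \<and> no_isolated_vertices (induced G ?U)) \<and>
      H_eigenpair (principal_subtensor (signless_laplacian_tensor k ?H) ?UU) l (restrict x ?UU) \<and>
      matrix_eigenpair ?M l ?y \<and>
      signless_laplacian_matrix (modified_induced G ?U) = ?M"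
      by (simp add: simple_graph_with_loops_def del: restrict_apply)
  qed
qed

end
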